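(* Let $A$ be a C*-algebra of type $c_0\text{-}\sum_i\oplus\mathrm K(H_i)$, i.e. a C*-algebra of compact operators on a certain Hilbert space. Let $\{\mathcal F,\langle\cdot,\cdot\rangle\}$ be a Hilbert $A$-module and $B$ be another C*-algebra admitting a $*$-representation in $\mathrm{End}_A^*(\mathcal F)$, so that $\mathcal F$ is a Hilbert $A$-$B$-bimodule. Then $\mathcal F$ is a projective object in $\mathcal B(A,B)$.
   Context: Hilbert $A$-modules are left $A$-modules with an $A$-valued inner product that is $A$-linear in the first argument, complete in the norm $\|x\|=\|\langle x,x\rangle\|^{1/2}$. $\mathrm{End}_A^*(\mathcal F)$ is the C*-algebra of adjointable bounded $A$-linear operators on $\mathcal F$. A Hilbert $A$-$B$-bimodule is a Hilbert $A$-module $\mathcal M$ together with a right action of the C*-algebra $B$ by bounded adjointable $A$-linear maps given by a $*$-representation, so that $\langle a m_1 b,m_2\rangle=a\langle m_1,m_2b^*\rangle$. $\mathcal B(A,B)$ is the category whose objects are Hilbert $A$-$B$-bimodules and whose morphisms are all bounded $A$-$B$-bimodule maps (not necessarily adjointable). An object $\mathcal F$ is projective in $\mathcal B(A,B)$ if for all Hilbert $A$-$B$-bimodules $\mathcal M,\mathcal N$, every surjective bounded bimodule map $T:\mathcal N\to\mathcal M$ and every bounded bimodule map $\phi:\mathcal F\to\mathcal M$, there is a bounded bimodule map $\psi:\mathcal F\to\mathcal N$ with $T\circ\psi=\phi$. A C*-algebra of type $c_0\text{-}\sum_i\oplus\mathrm K(H_i)$ is a $c_0$-direct sum, over an index set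 of arbitrary cardinality, of algebras $\mathrm K(H_i)$ of all compact operators on Hilbert spaces $H_i$; equivalently, a C*-algebra with a faithful $*$-representation as a C*-subalgebra of the compact operators on some Hilbert space. *)

theory Defs
  imports "HOL-Analysis.Analysis"
begin

section \<open>Complex Banach spaces, Hilbert spaces and C*-algebras\<close>

class complex_vector = real_vector +
  fixes scaleC :: "complex \<Rightarrow> 'a \<Rightarrow> 'a"  (infixr "*\<^sub>C" 75)
  assumes scaleC_add_right: "c *\<^sub>C (x + y) = c *\<^sub>C x + c *\<^sub>C y"
    and scaleC_add_left: "(c + d) *\<^sub>C x = c *\<^sub>C x + d *\<^sub>C x"
    and scaleC_scaleC: "c *\<^sub>C (d *\<^sub>C x) = (c * d) *\<^sub>C x"
    and scaleC_of_real: "complex_of_real r *\<^sub>C x = r *\<^sub>R x"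

class complex_normed_vector = complex_vector + real_normed_vector +
  assumes norm_scaleC: "norm (c *\<^sub>C x) = cmod c * norm x"

class cbanach = complex_normed_vector + banach

text \<open>The inner product is linear in the first argument, as for Hilbert modules below.\<close>

class chilbert_space = cbanach +
  fixes cinner :: "'a \<Rightarrow> 'a \<Rightarrow> complex"
  assumes cinner_add_left: "cinner (x + y) z = cinner x z + cinner y z"
    and cinner_scaleC_left: "cinner (c *\<^sub>C x) y = c * cinner x y"
    and cinner_commute: "cinner y x = cnj (cinner x y)"
    and cinner_self: "cinner x x = complex_of_real ((norm x)\<^sup>2)"

text \<open>C*-algebras are not assumed to have a unit.\<close>

class cstar_algebra = cbanach + real_normed_algebra +
  fixes star :: "'a \<Rightarrow> 'a"
  assumes mult_scaleC_left: "(c *\<^sub>C a) * b = c *\<^sub>C (a * b)"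
    and mult_scaleC_right: "a * (c *\<^sub>C b) = c *\<^sub>C (a * b)"
    and star_add: "star (a + b) = star a + star b"
    and star_scaleC: "star (c *\<^sub>C a) = cnj c *\<^sub>C star a"
    and star_mult: "star (a * b) = star b * star a"
    and star_star: "star (star a) = a"
    and cstar_identity: "norm (star a * a) = (norm a)\<^sup>2"

definition cstar_nonneg :: "'a::cstar_algebra \<Rightarrow> bool"
  where "cstar_nonneg a \<longleftrightarrow> (\<exists>b. a = star b * b)"

definition bounded_clinear :: "('m::complex_normed_vector \<Rightarrow> 'n::complex_normed_vector) \<Rightarrow> bool"
  where "bounded_clinear T \<longleftrightarrow> bounded_linear T \<and> (\<forall>c x. T (c *\<^sub>C x) = c *\<^sub>C T x)"


section \<open>C*-algebras of compact operators\<close>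

text \<open>
  The members of a family of Hilbert spaces may have different dimensions, so they are not
  modelled by one type each but as closed subspaces \<open>H i\<close> of a common Hilbert space. The
  subspaces need not be orthogonal or distinct. Every family of Hilbert spaces has this form
  up to isomorphism, inside its Hilbert space direct sum.
\<close>

definition closed_csubspace :: "'h::complex_normed_vector set \<Rightarrow> bool"
  where "closed_csubspace V \<longleftrightarrow> closed V \<and> 0 \<in> V \<and> (\<forall>x\<in>V. \<forall>y\<in>V. x + y \<in> V) \<and>
    (\<forall>c. \<forall>x\<in>V. c *\<^sub>C x \<in> V)"

text \<open>
  K(V): operators on \<open>V\<close> are extensional functions (\<open>undefined\<close> off \<open>V\<close>), so that function
  equality is equality of operators on \<open>V\<close>.
\<close>

definition compact_operators :: "'h::complex_normed_vector set \<Rightarrow> ('h \<Rightarrow> 'h) set"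
  where "compact_operators V = {T \<in> V \<rightarrow>\<^sub>E V.
    (\<forall>x\<in>V. \<forall>y\<in>V. T (x + y) = T x + T y) \<and>
    (\<forall>c. \<forall>x\<in>V. T (c *\<^sub>C x) = c *\<^sub>C T x) \<and>
    compact (closure (T ` (V \<inter> cball 0 1)))}"

definition opnorm_on :: "'h::complex_normed_vector set \<Rightarrow> ('h \<Rightarrow> 'h) \<Rightarrow> real"
  where "opnorm_on V T = (SUP x\<in>V \<inter> cball 0 1. norm (T x))"

definition c0_sum_compact :: "('i \<Rightarrow> 'h::complex_normed_vector set) \<Rightarrow> ('i \<Rightarrow> 'h \<Rightarrow> 'h) set"
  where "c0_sum_compact H = {T. (\<forall>i. T i \<in> compact_operators (H i)) \<and>
    (\<forall>\<epsilon>>0. finite {i. opnorm_on (H i) (T i) \<ge> \<epsilon>})}"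

text \<open>
  \<open>\<Phi>\<close> is an isometric *-isomorphism of the C*-algebra \<open>'a\<close> onto the \<open>c\<^sub>0\<close>-direct sum of the
  algebras K(\<open>H i\<close>), with entrywise operations and the supremum norm. The index set is the type
  \<open>'i\<close>; the empty sum is covered because \<open>H i = {0}\<close> is allowed.
\<close>

definition cstar_iso_c0_sum ::
    "('i \<Rightarrow> 'h::chilbert_space set) \<Rightarrow> ('a::cstar_algebra \<Rightarrow> 'i \<Rightarrow> 'h \<Rightarrow> 'h) \<Rightarrow> bool"
  where "cstar_iso_c0_sum H \<Phi> \<longleftrightarrow>
    bij_betw \<Phi> UNIV (c0_sum_compact H) \<and>
    (\<forall>a b i. \<forall>x\<in>H i. \<Phi> (a + b) i x = \<Phi> a i x + \<Phi> b i x) \<and>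
    (\<forall>c a i. \<forall>x\<in>H i. \<Phi> (c *\<^sub>C a) i x = c *\<^sub>C \<Phi> a i x) \<and>
    (\<forall>a b i. \<forall>x\<in>H i. \<Phi> (a * b) i x = \<Phi> a i (\<Phi> b i x)) \<and>
    (\<forall>a i. \<forall>x\<in>H i. \<forall>y\<in>H i. cinner (\<Phi> (star a) i x) y = cinner x (\<Phi> a i y)) \<and>
    (\<forall>a. norm a = (SUP i. opnorm_on (H i) (\<Phi> a i)))"

definition of_type_c0_sum_compact ::
    "'a::cstar_algebra itself \<Rightarrow> ('i \<Rightarrow> 'h::chilbert_space set) \<Rightarrow> bool"
  where "of_type_c0_sum_compact _ H \<longleftrightarrow>
    (\<forall>i. closed_csubspace (H i)) \<and>
    (\<exists>\<Phi> :: 'a \<Rightarrow> 'i \<Rightarrow> 'h \<Rightarrow> 'h. cstar_iso_c0_sum H \<Phi>)"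


section \<open>Hilbert modules and bimodules\<close>

text \<open>
  The norm of a Hilbert \<open>'a\<close>-module is the norm of the type \<open>'m\<close>, tied to the inner product by
  \<open>norm_ip\<close>; completeness is part of class \<open>cbanach\<close>.
\<close>

locale hilbert_module =
  fixes smul :: "'a::cstar_algebra \<Rightarrow> 'm::cbanach \<Rightarrow> 'm"
    and ip :: "'m \<Rightarrow> 'm \<Rightarrow> 'a"
  assumes smul_add_right: "smul a (x + y) = smul a x + smul a y"
    and smul_add_left: "smul (a + b) x = smul a x + smul b x"
    and smul_smul: "smul a (smul b x) = smul (a * b) x"
    and smul_scaleC_left: "smul (c *\<^sub>C a) x = c *\<^sub>C smul a x"
    and smul_scaleC_right: "smul a (c *\<^sub>C x) = c *\<^sub>C smul a x"
    and ip_add_left: "ip (x + y) z = ip x z + ip y z"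
    and ip_scaleC_left: "ip (c *\<^sub>C x) y = c *\<^sub>C ip x y"
    and ip_smul_left: "ip (smul a x) y = a * ip x y"
    and ip_star: "ip y x = star (ip x y)"
    and ip_nonneg: "cstar_nonneg (ip x x)"
    and ip_definite: "ip x x = 0 \<Longrightarrow> x = 0"
    and norm_ip: "norm x = sqrt (norm (ip x x))"

definition adjointable_endos ::
    "('a::cstar_algebra \<Rightarrow> 'm::cbanach \<Rightarrow> 'm) \<Rightarrow> ('m \<Rightarrow> 'm \<Rightarrow> 'a) \<Rightarrow> ('m \<Rightarrow> 'm) set"
  where "adjointable_endos smul ip = {T. bounded_clinear T \<and>
    (\<forall>a x. T (smul a x) = smul a (T x)) \<and>
    (\<exists>S. \<forall>x y. ip (T x) y = ip x (S y))}"

text \<open>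
  A *-representation of \<open>'b\<close> by adjointable operators, written on the right of their arguments as
  usual for left modules: \<open>ract x b\<close> is \<open>x b\<close>, and \<open>b c\<close> acts by first \<open>b\<close>, then \<open>c\<close>. The
  representation need be neither faithful nor nondegenerate.
\<close>

locale hilbert_bimodule = hilbert_module smul ip
  for smul :: "'a::cstar_algebra \<Rightarrow> 'm::cbanach \<Rightarrow> 'm"
    and ip :: "'m \<Rightarrow> 'm \<Rightarrow> 'a" +
  fixes ract :: "'m \<Rightarrow> 'b::cstar_algebra \<Rightarrow> 'm"
  assumes ract_adjointable: "(\<lambda>x. ract x b) \<in> adjointable_endos smul ip"
    and ract_add: "ract x (b + c) = ract x b + ract x c"
    and ract_scaleC: "ract x (k *\<^sub>C b) = k *\<^sub>C ract x b"
    and ract_mult: "ract x (b * c) = ract (ract x b) c"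
    and ract_star: "ip (ract x b) y = ip x (ract y (star b))"

text \<open>Morphisms of the category B(A,B); no adjoint is required.\<close>

definition bimodule_map ::
    "('a \<Rightarrow> 'm::cbanach \<Rightarrow> 'm) \<Rightarrow> ('m \<Rightarrow> 'b \<Rightarrow> 'm) \<Rightarrow>
     ('a \<Rightarrow> 'n::cbanach \<Rightarrow> 'n) \<Rightarrow> ('n \<Rightarrow> 'b \<Rightarrow> 'n) \<Rightarrow> ('m \<Rightarrow> 'n) \<Rightarrow> bool"
  where "bimodule_map smulM ractM smulN ractN T \<longleftrightarrow> bounded_clinear T \<and>
    (\<forall>a x. T (smulM a x) = smulN a (T x)) \<and>
    (\<forall>x b. T (ractM x b) = ractN (T x) b)"

text \<open>
  Projectivity of the object \<open>(smulF, ipF, ractF)\<close> in B(A,B). A definition in HOL cannot quantify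
  over types, so the carrier types \<open>'m\<close> of M and \<open>'n\<close> of N are parameters; a theorem
  concluding this for type variables \<open>'m\<close> and \<open>'n\<close> asserts it for all M and N.
\<close>

definition projective_object ::
    "'m::cbanach itself \<Rightarrow> 'n::cbanach itself \<Rightarrow>
     ('a::cstar_algebra \<Rightarrow> 'f::cbanach \<Rightarrow> 'f) \<Rightarrow> ('f \<Rightarrow> 'f \<Rightarrow> 'a) \<Rightarrow>
     ('f \<Rightarrow> 'b::cstar_algebra \<Rightarrow> 'f) \<Rightarrow> bool"
  where "projective_object _ _ smulF ipF ractF \<longleftrightarrow>
    hilbert_bimodule smulF ipF ractF \<and>
    (\<forall>(smulM :: 'a \<Rightarrow> 'm \<Rightarrow> 'm) ipM (ractM :: 'm \<Rightarrow> 'b \<Rightarrow> 'm)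
      (smulN :: 'a \<Rightarrow> 'n \<Rightarrow> 'n) ipN (ractN :: 'n \<Rightarrow> 'b \<Rightarrow> 'n) T \<phi>.
      hilbert_bimodule smulM ipM ractM \<longrightarrow>
      hilbert_bimodule smulN ipN ractN \<longrightarrow>
      bimodule_map smulN ractN smulM ractM T \<longrightarrow> surj T \<longrightarrow>
      bimodule_map smulF ractF smulM ractM \<phi> \<longrightarrow>
      (\<exists>\<psi>. bimodule_map smulF ractF smulN ractN \<psi> \<and> T \<circ> \<psi> = \<phi>))"

end

theory Submission
  imports Defs
begin

text \<open>
  Over a C*-algebra \<open>A\<close> of compact operators every closed submodule \<open>L\<close> of a Hilbert module is
  an orthogonal summand. For a minimal projection \<open>e\<close> we have \<open>e A e = \<complex> e\<close>, so the \<open>e\<close>-fixed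
  part of the module is a Hilbert space and \<open>e x\<close> has a nearest point in \<open>e L\<close>; the difference is
  orthogonal to \<open>e L\<close> and therefore to \<open>L\<close>. The set \<open>L + L\<^sup>\<bottom>\<close> is closed and contains the vectors \<open>e x\<close>,
  hence everything, because finite sums of minimal projections approximate the compact operator
  \<open>\<langle>x,x\<rangle>\<close>.

  A surjective bimodule map \<open>T\<close> thus restricts to a bijection from \<open>(ker T)\<^sup>\<bottom>\<close>, which is invariant
  under both actions, onto its target. The inverse is bounded by the open mapping theorem and
  splits \<open>T\<close>, and lifts are obtained by composing with it.
\<close>

section \<open>Open mapping theorem and nearest points\<close>

text \<open>This is the open mapping theorem in quantitative form. Baire puts a ball into the
  closure of the image of some ball; differences recentre it at 0, and a geometric series of
  corrections removes the closure.\<close>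

lemma surj_bounded_linear_bounded_section:
  fixes T :: "'n::banach \<Rightarrow> 'm::banach"
  assumes T: "bounded_linear T" and surj: "surj T"
  obtains C where "C \<ge> 0" "\<And>y. \<exists>x. T x = y \<and> norm x \<le> C * norm y"
proof -
  interpret T: bounded_linear T by fact
  define F where "F n = closure (T ` cball 0 (real n))" for n :: nat
  have "\<exists>n. interior (F n) \<noteq> {}"
  proof (rule ccontr)
    assume "\<not> ?thesis"
    then have "euclidean interior_of \<Union>(range F) = {}"
      by (intro Baire_category_alt) (auto simp: F_def completely_metrizable_space_euclidean)
    moreover have "\<Union>(range F) = UNIV"
    proof (intro equalityI subset_UNIV subsetI)
      fix y :: 'm
      obtain x where "y = T x" using surj by blast
      moreover obtain n where "norm x \<le> real n" using real_arch_simple by blast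
      ultimately have "y \<in> F n"
        unfolding F_def by (intro closure_subset[THEN subsetD] image_eqI[of _ _ x]) auto
      then show "y \<in> \<Union>(range F)" by blast
    qed
    ultimately show False by simp
  qed
  then obtain n y0 where "y0 \<in> interior (F n)" by blast
  then obtain r where r: "r > 0" "cball y0 r \<subseteq> F n"
    using mem_interior_cball by blast
  \<comment> \<open>Two approximate preimages of norm at most \<open>n\<close> will be subtracted
    and rescaled by \<open>norm y / r\<close>, which produces this constant.\<close>
  define K where "K = 2 * real n / r"
  have K: "K \<ge> 0" using r(1) by (simp add: K_def)
  have approx: "\<exists>x. norm x \<le> K * norm y \<and> norm (y - T x) \<le> norm y / 2" for y
  proof (cases "y = 0")
    case True
    then show ?thesis by (intro exI[of _ 0]) simp
  next
    case False
    \<comment> \<open>This scale keeps \<open>y0 + c *\<^sub>R y\<close> inside the ball of radius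
      \<open>r\<close>. Approximating it and \<open>y0\<close> to within \<open>r / 4\<close> leaves
      an error of \<open>r / 2\<close>, which is \<open>norm y / 2\<close> after division by
      \<open>c\<close>.\<close>
    define c where "c = r / norm y"
    have c: "c > 0" using r(1) False by (simp add: c_def)
    have "y0 + c *\<^sub>R y \<in> F n" "y0 \<in> F n"
      using r(1) False by (auto intro!: r(2)[THEN subsetD] simp: c_def dist_norm)
    moreover have "\<exists>x. norm x \<le> real n \<and> dist (T x) w < r / 4" if "w \<in> F n" for w
    proof -
      have "\<exists>v\<in>T ` cball 0 (real n). dist v w < r / 4"
        using that r(1) unfolding F_def closure_approachable
        by (metis divide_pos_pos zero_less_numeral)
      then show ?thesis by auto
    qed
    ultimately obtain x1 x2 where x:
      "norm x1 \<le> real n" "dist (T x1) (y0 + c *\<^sub>R y) < r / 4"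
      "norm x2 \<le> real n" "dist (T x2) y0 < r / 4"
      by metis
    define x where "x = (1 / c) *\<^sub>R (x1 - x2)"
    have "norm (x1 - x2) \<le> 2 * real n"
      using x norm_triangle_ineq4[of x1 x2] by linarith
    then have "norm x \<le> (1 / c) * (2 * real n)"
      using c unfolding x_def by (simp add: divide_right_mono)
    also have "\<dots> = K * norm y" by (simp add: c_def K_def)
    finally have 1: "norm x \<le> K * norm y" .
    have "norm (c *\<^sub>R y - (T x1 - T x2)) \<le> r / 2"
    proof -
      have eq: "c *\<^sub>R y - (T x1 - T x2) = (T x2 - y0) - (T x1 - (y0 + c *\<^sub>R y))" by simp
      show ?thesis
        unfolding eq using x(2,4) norm_triangle_ineq4[of "T x2 - y0" "T x1 - (y0 + c *\<^sub>R y)"]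
        unfolding dist_norm by linarith
    qed
    moreover have "y - T x = (1 / c) *\<^sub>R (c *\<^sub>R y - (T x1 - T x2))"
      using c by (simp add: x_def T.scaleR T.diff scaleR_diff_right)
    ultimately have "norm (y - T x) \<le> (1 / c) * (r / 2)"
      using c by (simp add: pos_divide_le_eq)
    also have "\<dots> = norm y / 2" using r(1) by (simp add: c_def)
    finally show ?thesis using 1 by blast
  qed
  then obtain g where g: "\<And>y. norm (g y) \<le> K * norm y" "\<And>y. norm (y - T (g y)) \<le> norm y / 2"
    by metis
  have "\<exists>x. T x = y \<and> norm x \<le> (2 * K) * norm y" for y
  proof -
    \<comment> \<open>\<open>z k\<close> is the residual after \<open>k\<close> corrections. Since
      \<open>T (g (z k)) = z k - z (Suc k)\<close>, the series telescopes to
      \<open>y\<close>.\<close>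
    define z where "z k = ((\<lambda>y. y - T (g y)) ^^ k) y" for k
    have z: "norm (z k) \<le> norm y * (1/2) ^ k" for k
    proof (induction k)
      case (Suc k)
      have "norm (z (Suc k)) \<le> norm (z k) / 2" using g(2)[of "z k"] by (simp add: z_def)
      also have "\<dots> \<le> norm y * (1/2) ^ Suc k" using Suc by simp
      finally show ?case .
    qed (simp add: z_def)
    have gz: "norm (g (z k)) \<le> K * norm y * (1/2) ^ k" for k
      using order_trans[OF g(1)[of "z k"] mult_left_mono[OF z[of k] K]] by (simp add: mult.assoc)
    have geo: "(\<lambda>k. K * norm y * (1/2::real) ^ k) sums (K * norm y * 2)"
      using sums_mult[OF geometric_sums[of "1/2::real"], of "K * norm y"] by simp
    have sn: "summable (\<lambda>k. norm (g (z k)))"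
      by (rule summable_comparison_test'[of "\<lambda>k. K * norm y * (1/2) ^ k" 0])
        (use geo gz in \<open>auto simp: sums_iff\<close>)
    define x where "x = (\<Sum>k. g (z k))"
    have "(\<lambda>k. T (g (z k))) sums T x"
      unfolding x_def by (rule T.sums[OF summable_sums[OF summable_norm_cancel[OF sn]]])
    moreover have "(\<lambda>k. T (g (z k))) sums y"
    proof -
      have "(\<lambda>k. norm y * (1/2) ^ k) \<longlonglongrightarrow> 0"
        by (intro tendsto_mult_right_zero LIMSEQ_power_zero) simp
      then have "z \<longlonglongrightarrow> 0"
        by (rule Lim_null_comparison[rotated]) (use z in auto)
      from telescope_sums'[OF this] show ?thesis by (simp add: z_def)
    qed
    ultimately have "T x = y" using sums_unique2 by blast
    moreover have "norm x \<le> (\<Sum>k. norm (g (z k)))" unfolding x_def by (rule summable_norm[OF sn])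
    then have "norm x \<le> K * norm y * 2"
      using suminf_le[OF gz sn] geo by (auto simp: sums_iff)
    ultimately show ?thesis by (auto simp: mult_ac)
  qed
  then show ?thesis using that[of "2 * K"] K by simp
qed

text \<open>A minimising sequence is Cauchy by the parallelogram law. The law is assumed only for
  differences from \<open>x\<close>, because it will be available in the part of a module fixed by a
  minimal projection but not in general in the whole module.\<close>

lemma nearest_point_exists:
  fixes S :: "'m::banach set"
  assumes S: "closed S" "S \<noteq> {}"
    and mid: "\<And>u v. u \<in> S \<Longrightarrow> v \<in> S \<Longrightarrow> (1/2) *\<^sub>R (u + v) \<in> S"
    and parallelogram: "\<And>u v. u \<in> S \<Longrightarrow> v \<in> S \<Longrightarrow>
      (norm ((x - u) + (x - v)))\<^sup>2 + (norm (u - v))\<^sup>2 = 2 * (norm (x - u))\<^sup>2 + 2 * (norm (x - v))\<^sup>2"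
  shows "\<exists>y\<in>S. \<forall>z\<in>S. norm (x - y) \<le> norm (x - z)"
proof -
  define D where "D = (INF z\<in>S. (norm (x - z))\<^sup>2)"
  have bdd: "bdd_below ((\<lambda>z. (norm (x - z))\<^sup>2) ` S)" by (rule bdd_belowI2[of _ 0]) simp
  have D: "D \<le> (norm (x - z))\<^sup>2" if "z \<in> S" for z
    unfolding D_def using bdd that by (rule cINF_lower)
  have "\<exists>z\<in>S. (norm (x - z))\<^sup>2 < D + 1 / real (Suc n)" for n
    using cINF_less_iff[OF S(2) bdd, of "D + 1 / real (Suc n)"] by (simp add: D_def)
  then obtain f where f: "\<And>n. f n \<in> S" "\<And>n. (norm (x - f n))\<^sup>2 < D + 1 / real (Suc n)"
    by metis
  have fmn: "(norm (f m - f n))\<^sup>2 < 2 / real (Suc m) + 2 / real (Suc n)" for m n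
  proof -
    \<comment> \<open>The midpoint lies in \<open>S\<close>, so the squared norm of the sum is at
      least \<open>4 * D\<close>; the parallelogram law then leaves only the two error terms for
      \<open>f m - f n\<close>.\<close>
    have "(x - f m) + (x - f n) = 2 *\<^sub>R (x - (1/2) *\<^sub>R (f m + f n))"
      by (simp add: algebra_simps scaleR_2)
    then have "(norm ((x - f m) + (x - f n)))\<^sup>2 = 4 * (norm (x - (1/2) *\<^sub>R (f m + f n)))\<^sup>2"
      by (simp add: power_mult_distrib)
    then show ?thesis
      using D[OF mid[OF f(1)[of m] f(1)[of n]]] parallelogram[OF f(1)[of m] f(1)[of n]]
        f(2)[of m] f(2)[of n] by simp
  qed
  have "Cauchy f"
  proof (rule CauchyI)
    fix e :: real assume e: "e > 0"
    obtain N where N: "4 / e\<^sup>2 < real N" using reals_Archimedean2 by blast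
    have "norm (f m - f n) < e" if "m \<ge> N" "n \<ge> N" for m n
    proof -
      have *: "2 / real (Suc k) \<le> e\<^sup>2 / 2" if "k \<ge> N" for k
      proof -
        have "4 / e\<^sup>2 < real (Suc k)" using N that by simp
        then show ?thesis using e by (simp add: field_simps)
      qed
      have "(norm (f m - f n))\<^sup>2 < e\<^sup>2" using fmn[of m n] *[OF that(1)] *[OF that(2)] by linarith
      then show ?thesis using e by (meson less_imp_le power2_less_imp_less)
    qed
    then show "\<exists>N. \<forall>m\<ge>N. \<forall>n\<ge>N. norm (f m - f n) < e" by blast
  qed
  then obtain y where y: "f \<longlonglongrightarrow> y" using Cauchy_convergent convergent_def by blast
  have yS: "y \<in> S" using S(1) f(1) y closed_sequentially by blast
  have "(norm (x - y))\<^sup>2 \<le> D"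
  proof (rule LIMSEQ_le)
    show "(\<lambda>n. (norm (x - f n))\<^sup>2) \<longlonglongrightarrow> (norm (x - y))\<^sup>2" by (intro tendsto_intros y)
    have "(\<lambda>n. D + 1 / real (Suc n)) \<longlonglongrightarrow> D + 0"
      by (intro tendsto_intros LIMSEQ_inverse_real_of_nat[unfolded inverse_eq_divide])
    then show "(\<lambda>n. D + 1 / real (Suc n)) \<longlonglongrightarrow> D" by simp
    show "\<exists>N. \<forall>n\<ge>N. (norm (x - f n))\<^sup>2 \<le> D + 1 / real (Suc n)" using f(2) less_imp_le by blast
  qed
  then have "norm (x - y) \<le> norm (x - z)" if "z \<in> S" for z
    using D[OF that] by (meson norm_ge_zero order_trans power2_le_imp_le)
  then show ?thesis using yS by blast
qed

section \<open>Positive semidefinite sesquilinear forms and Hilbert spaces\<close>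

lemma scaleC_0_left [simp]: "0 *\<^sub>C (x::'v::complex_vector) = 0"
  using scaleC_of_real[of 0 x] by simp

lemma scaleC_1_left [simp]: "1 *\<^sub>C (x::'v::complex_vector) = x"
  using scaleC_of_real[of 1 x] by simp

lemma scaleC_minus1_left: "(-1) *\<^sub>C (x::'v::complex_vector) = - x"
  using scaleC_of_real[of "-1" x] by simp

lemma scaleC_0_right [simp]: "c *\<^sub>C (0::'v::complex_vector) = 0"
  using scaleC_add_right[of c "0::'v" 0] by simp

lemma scaleC_diff_left: "(c - d) *\<^sub>C (x::'v::complex_vector) = c *\<^sub>C x - d *\<^sub>C x"
  using scaleC_add_left[of "c - d" d x] by simp

text \<open>Semidefinite forms cover both Hilbert space inner products and the scalar forms obtained
  from a module inner product by a vector functional, which may be degenerate.\<close>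

locale psd_form =
  fixes f :: "'v::complex_vector \<Rightarrow> 'v \<Rightarrow> complex"
  assumes add_left: "f (x + y) z = f x z + f y z"
    and scaleC_left: "f (c *\<^sub>C x) y = c * f x y"
    and commute: "f y x = cnj (f x y)"
    and nonneg: "0 \<le> Re (f x x)"
begin

lemma add_right: "f x (y + z) = f x y + f x z"
  by (subst (1 2 3) commute) (simp add: add_left)

lemma scaleC_right: "f x (c *\<^sub>C y) = cnj c * f x y"
  by (subst (1 2) commute) (simp add: scaleC_left)

lemma minus_left: "f (- x) y = - f x y"
  using scaleC_left[of "-1" x y] by (simp add: scaleC_minus1_left)

lemma minus_right: "f x (- y) = - f x y"
  using scaleC_right[of x "-1" y] by (simp add: scaleC_minus1_left)

lemma diff_left: "f (x - y) z = f x z - f y z"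
  using add_left[of x "- y" z] by (simp add: minus_left)

lemma diff_right: "f x (y - z) = f x y - f x z"
  using add_right[of x y "- z"] by (simp add: minus_right)

lemma zero_left [simp]: "f 0 x = 0"
  using scaleC_left[of 0 0 x] by simp

lemma zero_right [simp]: "f x 0 = 0"
  using commute[of 0 x] by simp

lemma sum_left: "f (\<Sum>s\<in>S. g s) y = (\<Sum>s\<in>S. f (g s) y)"
  by (induction S rule: infinite_finite_induct) (auto simp: add_left)

lemma self_real: "f x x = complex_of_real (Re (f x x))"
  using commute[of x x] by (simp add: complex_eq_iff)

text \<open>Choosing the coefficient as a real multiple of \<open>f x y\<close> makes the cross
  terms real, so one real quadratic in \<open>s\<close> serves both the Cauchy-Schwarz inequality
  and the orthogonality of minimisers.\<close>

lemma diff_multiple: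
  "Re (f (x - (of_real s * f x y) *\<^sub>C y) (x - (of_real s * f x y) *\<^sub>C y))
    = Re (f x x) - 2 * s * (cmod (f x y))\<^sup>2 + s\<^sup>2 * (cmod (f x y))\<^sup>2 * Re (f y y)"
proof -
  let ?c = "f x y"
  have "f (x - (of_real s * ?c) *\<^sub>C y) (x - (of_real s * ?c) *\<^sub>C y)
    = f x x - 2 * of_real s * (?c * cnj ?c) + (of_real s)\<^sup>2 * (?c * cnj ?c) * f y y"
    by (simp add: diff_left diff_right scaleC_left scaleC_right commute[of y x]
        algebra_simps power2_eq_square)
  also have "\<dots> = of_real (Re (f x x) - 2 * s * (cmod ?c)\<^sup>2 + s\<^sup>2 * (cmod ?c)\<^sup>2 * Re (f y y))"
    by (subst self_real[of x], subst self_real[of y]) (simp add: complex_norm_square[symmetric])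
  finally show ?thesis by simp
qed

lemma Cauchy_Schwarz: "(cmod (f x y))\<^sup>2 \<le> Re (f x x) * Re (f y y)"
proof -
  let ?p = "Re (f x x)" and ?q = "Re (f y y)" and ?c = "(cmod (f x y))\<^sup>2"
  have *: "0 \<le> ?p - 2 * s * ?c + s\<^sup>2 * ?c * ?q" for s
    using nonneg diff_multiple[of x s y] by metis
  show ?thesis
  proof (cases "?q = 0")
    case True
    have "?c = 0"
    proof (rule ccontr)
      assume "?c \<noteq> 0"
      \<comment> \<open>With \<open>?q = 0\<close> the quadratic is linear in \<open>s\<close>, and
        this value of \<open>s\<close> makes it equal to \<open>- ?p - 2\<close>.\<close>
      then show False using *[of "(?p + 1) / ?c"] True nonneg[of x] by simp
    qed
    then show ?thesis using True by simp
  next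
    case False
    then have "?q > 0" using nonneg[of y] by simp
    \<comment> \<open>The quadratic attains its minimum at \<open>s = 1 / ?q\<close>.\<close>
    then show ?thesis using *[of "1 / ?q"] by (simp add: field_simps power2_eq_square)
  qed
qed

text \<open>A nonzero \<open>f x y\<close> would allow a small step along \<open>y\<close> to lower
  the value.\<close>

lemma orthogonal_if_minimal:
  assumes "\<And>t. Re (f x x) \<le> Re (f (x - t *\<^sub>C y) (x - t *\<^sub>C y))"
  shows "f x y = 0"
proof -
  let ?q = "Re (f y y)" and ?c = "(cmod (f x y))\<^sup>2"
  \<comment> \<open>The shift by 1 covers \<open>?q = 0\<close> as well, and
    \<open>s * ?q \<le> 1\<close> is enough to reduce the inequality to
    \<open>2 * ?c \<le> ?c\<close>.\<close>
  define s where "s = 1 / (?q + 1)"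
  have q: "?q \<ge> 0" by (rule nonneg)
  have s: "s > 0" "s * ?q \<le> 1" using q by (auto simp: s_def field_simps)
  have "2 * s * ?c \<le> s * (s * ?q) * ?c"
    using assms[of "of_real s * f x y"] unfolding diff_multiple
    by (simp add: power2_eq_square algebra_simps)
  then have "2 * ?c \<le> (s * ?q) * ?c" using s by (simp add: mult.assoc)
  also have "\<dots> \<le> 1 * ?c" by (intro mult_right_mono s) simp
  finally show ?thesis by simp
qed

end

interpretation cinner: psd_form "cinner :: 'h::chilbert_space \<Rightarrow> 'h \<Rightarrow> complex"
  by unfold_locales (auto simp: cinner_add_left cinner_scaleC_left cinner_self intro: cinner_commute)

lemma cinner_norm_le: "cmod (cinner x y) \<le> norm x * norm (y::'h::chilbert_space)"
proof -
  have "(cmod (cinner x y))\<^sup>2 \<le> (norm x * norm y)\<^sup>2"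
    using cinner.Cauchy_Schwarz[of x y] by (simp add: cinner_self power_mult_distrib)
  then show ?thesis by (rule power2_le_imp_le) simp
qed

lemma norm_le_by_cinner:
  fixes x :: "'h::chilbert_space"
  assumes "(norm x)\<^sup>2 \<le> c * norm x" "0 \<le> c"
  shows "norm x \<le> c"
  using assms by (cases "x = 0") (auto simp: power2_eq_square)

section \<open>Projections onto finite orthonormal systems\<close>

definition fin_proj :: "'h::chilbert_space set \<Rightarrow> 'h \<Rightarrow> 'h"
  where "fin_proj S x = (\<Sum>s\<in>S. cinner x s *\<^sub>C s)"

definition orthonormal :: "'h::chilbert_space set \<Rightarrow> bool"
  where "orthonormal S \<longleftrightarrow> (\<forall>s\<in>S. \<forall>t\<in>S. cinner s t = (if s = t then 1 else 0))"

text \<open>\<open>fin_proj S\<close> is thereby the orthogonal projection onto the span of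
  \<open>S\<close>: pairing the sum with \<open>t\<close> keeps only the coefficient at
  \<open>t\<close>.\<close>

lemma fin_proj_residual_orthogonal:
  assumes "finite S" "orthonormal S" "t \<in> S"
  shows "cinner (x - fin_proj S x) t = 0"
proof -
  have "cinner (fin_proj S x) t = (\<Sum>s\<in>S. cinner x s * (if s = t then 1 else 0))"
    using assms(2,3) unfolding fin_proj_def cinner.sum_left cinner_scaleC_left
    by (intro sum.cong refl) (auto simp: orthonormal_def)
  also have "\<dots> = cinner x t"
    using assms(1,3) by (simp add: if_distrib[of "\<lambda>z. _ * z"] cong: if_cong)
  finally show ?thesis by (simp add: cinner.diff_left)
qed

text \<open>The residual \<open>r\<close> is orthogonal to the projection, so its squared norm is
  \<open>cinner x r\<close>, which Cauchy-Schwarz bounds.\<close>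

lemma fin_proj_residual_norm:
  assumes "finite S" "orthonormal S"
  shows "norm (x - fin_proj S x) \<le> norm x"
proof -
  let ?r = "x - fin_proj S x"
  have "cinner (fin_proj S x) ?r = 0"
  proof -
    have "cinner s ?r = 0" if "s \<in> S" for s
      using fin_proj_residual_orthogonal[OF assms that, of x] cinner_commute[of ?r s] by simp
    moreover have "cinner (fin_proj S x) y = (\<Sum>s\<in>S. cinner x s * cinner s y)" for y
      by (simp add: fin_proj_def cinner.sum_left cinner_scaleC_left)
    ultimately show ?thesis by simp
  qed
  then have "cinner ?r ?r = cinner x ?r" by (simp add: cinner.diff_left[of x])
  then have "(norm ?r)\<^sup>2 \<le> norm x * norm ?r"
    using cinner_norm_le[of x ?r] by (metis cinner_self norm_of_real abs_power2)
  then show ?thesis by (rule norm_le_by_cinner) simp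
qed

lemma fin_proj_minus: "fin_proj S (x - y) = fin_proj S x - fin_proj S y"
  by (simp add: fin_proj_def sum_subtractf cinner.diff_left scaleC_diff_left)

lemma closed_csubspaceD:
  assumes "closed_csubspace V"
  shows "closed V" "0 \<in> V" "x \<in> V \<Longrightarrow> y \<in> V \<Longrightarrow> x + y \<in> V" "x \<in> V \<Longrightarrow> c *\<^sub>C x \<in> V"
    "x \<in> V \<Longrightarrow> y \<in> V \<Longrightarrow> x - y \<in> V" "x \<in> V \<Longrightarrow> - x \<in> V"
    "(\<And>s. s \<in> S \<Longrightarrow> g s \<in> V) \<Longrightarrow> sum g S \<in> V"
proof -
  show 1: "closed V" "0 \<in> V" "\<And>x y. x \<in> V \<Longrightarrow> y \<in> V \<Longrightarrow> x + y \<in> V" "\<And>x c. x \<in> V \<Longrightarrow> c *\<^sub>C x \<in> V"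
    using assms unfolding closed_csubspace_def by auto
  show 2: "- x \<in> V" if "x \<in> V" for x
    using 1(4)[OF that, of "-1"] by (simp add: scaleC_minus1_left)
  show "x \<in> V \<Longrightarrow> y \<in> V \<Longrightarrow> x - y \<in> V"
    using 1(3)[of x "- y"] 2[of y] by simp
  show "(\<And>s. s \<in> S \<Longrightarrow> g s \<in> V) \<Longrightarrow> sum g S \<in> V"
    by (induction S rule: infinite_finite_induct) (auto intro: 1)
qed

text \<open>This provides finite rank projections that fix prescribed points, later a finite net of
  a compact set. Membership in the span of \<open>S\<close> is expressed as being fixed by the
  projection.\<close>

lemma Gram_Schmidt:
  assumes V: "closed_csubspace V" and "finite F" "F \<subseteq> V"
  obtains S where "finite S" "S \<subseteq> V" "orthonormal S" "\<And>x. x \<in> F \<Longrightarrow> fin_proj S x = x"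
  using assms(2,3)
proof (induction F arbitrary: thesis rule: finite_induct)
  case empty
  show ?case by (rule empty(1)[of "{}"]) (auto simp: orthonormal_def)
next
  case (insert y F)
  obtain S where S: "finite S" "S \<subseteq> V" "orthonormal S" "\<And>x. x \<in> F \<Longrightarrow> fin_proj S x = x"
    using insert.IH insert.prems by blast
  \<comment> \<open>This is the component of \<open>y\<close> orthogonal to the system found so far;
    its normalisation is the new vector, unless it vanishes and the old system suffices.\<close>
  define r where "r = y - fin_proj S y"
  have rV: "r \<in> V"
    unfolding r_def fin_proj_def using S(2) insert.prems(2)
    by (intro closed_csubspaceD(5)[OF V] closed_csubspaceD(7)[OF V] closed_csubspaceD(4)[OF V]) auto
  show ?case
  proof (cases "r = 0")
    case True
    then show ?thesis using S by (intro insert.prems(1)[of S]) (auto simp: r_def)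
  next
    case False
    define u where "u = of_real (1 / norm r) *\<^sub>C r"
    have ru: "r = of_real (norm r) *\<^sub>C u"
      using False by (simp add: u_def scaleC_scaleC flip: of_real_mult)
    have uu: "cinner u u = 1"
      using False by (simp add: u_def cinner_scaleC_left cinner.scaleC_right cinner_self[of r] power2_eq_square)
    have us: "cinner u s = 0" "cinner s u = 0" if "s \<in> S" for s
    proof -
      show 1: "cinner u s = 0"
        using fin_proj_residual_orthogonal[OF S(1,3) that, of y]
        by (simp add: u_def r_def cinner_scaleC_left)
      show "cinner s u = 0" using cinner_commute[of u s] 1 by simp
    qed
    have uS: "u \<notin> S" using us(1)[of u] uu by auto
    have ins: "fin_proj (insert u S) x = cinner x u *\<^sub>C u + fin_proj S x" for x
      using S(1) uS by (simp add: fin_proj_def)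
    have pu: "cinner (fin_proj S x) u = 0" for x
      by (simp add: fin_proj_def cinner.sum_left cinner_scaleC_left us)
    show ?thesis
    proof (rule insert.prems(1)[of "insert u S"])
      show "finite (insert u S)" using S by simp
      show "insert u S \<subseteq> V" using S rV closed_csubspaceD(4)[OF V] by (auto simp: u_def)
      show "orthonormal (insert u S)"
        using S(3) uu us uS by (auto simp: orthonormal_def)
      fix x assume x: "x \<in> insert y F"
      show "fin_proj (insert u S) x = x"
      proof (cases "x \<in> F")
        case True
        then have "fin_proj S x = x" by (rule S)
        then show ?thesis using pu[of x] by (simp add: ins)
      next
        case False
        then have x: "x = y" using x by simp
        have "cinner y u = cinner r u" unfolding r_def cinner.diff_left pu by simp
        also have "\<dots> = of_real (norm r)" by (subst ru) (simp add: cinner_scaleC_left uu)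
        finally have "cinner y u *\<^sub>C u = r" using ru by metis
        then show ?thesis unfolding ins x r_def by simp
      qed
    qed
  qed
qed

section \<open>C*-algebras of compact operators\<close>

lemma star_zero [simp]: "star (0::'a::cstar_algebra) = 0"
  using star_scaleC[of 0 "0::'a"] by simp

lemma star_sum: "star (\<Sum>s\<in>S. g s) = (\<Sum>s\<in>S. star (g s :: 'a::cstar_algebra))"
  by (induction S rule: infinite_finite_induct) (auto simp: star_add)

lemma norm_star [simp]: "norm (star a) = norm (a::'a::cstar_algebra)"
proof -
  have *: "norm b \<le> norm (star b)" for b :: 'a
  proof (cases "b = 0")
    case False
    have "norm b * norm b \<le> norm (star b) * norm b"
      using cstar_identity[of b] norm_mult_ineq[of "star b" b] by (simp add: power2_eq_square)
    then show ?thesis using False by simp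
  qed simp
  show ?thesis using *[of a] *[of "star a"] by (simp add: star_star)
qed

lemma mult_star_eq_0: "a * star a = 0 \<Longrightarrow> a = (0::'a::cstar_algebra)"
  using cstar_identity[of "star a"] by (simp add: star_star)

locale compact_type_algebra =
  fixes H :: "'i \<Rightarrow> 'h::chilbert_space set" and \<Phi> :: "'a::cstar_algebra \<Rightarrow> 'i \<Rightarrow> 'h \<Rightarrow> 'h"
  assumes subspace: "closed_csubspace (H i)"
    and iso: "cstar_iso_c0_sum H \<Phi>"
begin

section \<open>Entrywise calculus for elements as families of compact operators\<close>

lemmas H_closed = closed_csubspaceD[OF subspace]

lemma \<Phi>_c0: "\<Phi> a \<in> c0_sum_compact H"
  using iso unfolding cstar_iso_c0_sum_def bij_betw_def by blast

lemma \<Phi>_surj: "T \<in> c0_sum_compact H \<Longrightarrow> \<exists>a. \<Phi> a = T"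
  using iso unfolding cstar_iso_c0_sum_def bij_betw_def by (metis imageE)

lemma \<Phi>_compact: "\<Phi> a i \<in> compact_operators (H i)"
  using \<Phi>_c0 unfolding c0_sum_compact_def by blast

lemma \<Phi>_in: "x \<in> H i \<Longrightarrow> \<Phi> a i x \<in> H i"
  using \<Phi>_compact unfolding compact_operators_def by blast

lemma \<Phi>_add_right: "x \<in> H i \<Longrightarrow> y \<in> H i \<Longrightarrow> \<Phi> a i (x + y) = \<Phi> a i x + \<Phi> a i y"
  and \<Phi>_scaleC_right: "x \<in> H i \<Longrightarrow> \<Phi> a i (c *\<^sub>C x) = c *\<^sub>C \<Phi> a i x"
  using \<Phi>_compact[of a i] unfolding compact_operators_def by blast+

lemma \<Phi>_diff_right: "x \<in> H i \<Longrightarrow> y \<in> H i \<Longrightarrow> \<Phi> a i (x - y) = \<Phi> a i x - \<Phi> a i y"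
  using \<Phi>_add_right[of "x - y" i y a] by (simp add: H_closed)

lemma \<Phi>_zero_right [simp]: "\<Phi> a i 0 = 0"
  using \<Phi>_scaleC_right[of 0 i a 0] by (simp add: H_closed)

lemma \<Phi>_add: "x \<in> H i \<Longrightarrow> \<Phi> (a + b) i x = \<Phi> a i x + \<Phi> b i x"
  and \<Phi>_scaleC: "x \<in> H i \<Longrightarrow> \<Phi> (c *\<^sub>C a) i x = c *\<^sub>C \<Phi> a i x"
  and \<Phi>_mult: "x \<in> H i \<Longrightarrow> \<Phi> (a * b) i x = \<Phi> a i (\<Phi> b i x)"
  and \<Phi>_star: "x \<in> H i \<Longrightarrow> y \<in> H i \<Longrightarrow> cinner (\<Phi> (star a) i x) y = cinner x (\<Phi> a i y)"
  and norm_eq_SUP: "norm a = (SUP i. opnorm_on (H i) (\<Phi> a i))"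
  using iso unfolding cstar_iso_c0_sum_def by blast+

lemma \<Phi>_zero [simp]: "x \<in> H i \<Longrightarrow> \<Phi> 0 i x = 0"
  using \<Phi>_scaleC[of x i 0 0] by simp

lemma \<Phi>_diff: "x \<in> H i \<Longrightarrow> \<Phi> (a - b) i x = \<Phi> a i x - \<Phi> b i x"
  using \<Phi>_add[of x i "a - b" b] by simp

lemma \<Phi>_sum: "x \<in> H i \<Longrightarrow> \<Phi> (\<Sum>s\<in>S. g s) i x = (\<Sum>s\<in>S. \<Phi> (g s) i x)"
  by (induction S rule: infinite_finite_induct) (auto simp: \<Phi>_add)

lemma norm_\<Phi>_le_opnorm:
  assumes "x \<in> H i" "norm x \<le> 1"
  shows "norm (\<Phi> a i x) \<le> opnorm_on (H i) (\<Phi> a i)"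
proof -
  have "compact (closure (\<Phi> a i ` (H i \<inter> cball 0 1)))"
    using \<Phi>_compact[of a i] unfolding compact_operators_def by blast
  then have "bounded (\<Phi> a i ` (H i \<inter> cball 0 1))"
    using compact_imp_bounded bounded_subset closure_subset by blast
  then have "bdd_above ((\<lambda>x. norm (\<Phi> a i x)) ` (H i \<inter> cball 0 1))"
    unfolding bounded_iff bdd_above_def by blast
  then show ?thesis unfolding opnorm_on_def using assms by (intro cSUP_upper) auto
qed

lemma opnorm_on_le:
  assumes "\<And>x. x \<in> H i \<Longrightarrow> norm x \<le> 1 \<Longrightarrow> norm (T x) \<le> c"
  shows "opnorm_on (H i) T \<le> c"
  unfolding opnorm_on_def
proof (rule cSUP_least)
  show "H i \<inter> cball 0 1 \<noteq> {}" using H_closed(2)[of i] by (auto simp: set_eq_iff intro!: exI[of _ 0])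
qed (use assms in auto)

lemma finite_opnorm_ge: "\<epsilon> > 0 \<Longrightarrow> finite {i. opnorm_on (H i) (\<Phi> a i) \<ge> \<epsilon>}"
  using \<Phi>_c0[of a] unfolding c0_sum_compact_def by blast

lemma norm_\<Phi>_le: assumes "x \<in> H i" shows "norm (\<Phi> a i x) \<le> norm a * norm x"
proof -
  let ?n = "\<lambda>i. opnorm_on (H i) (\<Phi> a i)"
  \<comment> \<open>The supremum that defines the norm bounds its entries only once they are known
    to be bounded above: finitely many are at least 1, the others are below 1.\<close>
  have "range ?n \<subseteq> ?n ` {i. ?n i \<ge> 1} \<union> {..1}" by force
  moreover have "bdd_above (?n ` {i. ?n i \<ge> 1} \<union> {..1})" using finite_opnorm_ge[of 1 a] by simp
  ultimately have "bdd_above (range ?n)" by (rule bdd_above_mono[rotated])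
  then have n: "?n i \<le> norm a" unfolding norm_eq_SUP by (intro cSUP_upper) auto
  show ?thesis
  proof (cases "x = 0")
    case False
    let ?u = "of_real (1 / norm x) *\<^sub>C x"
    have "norm (\<Phi> a i ?u) \<le> norm a"
      using norm_\<Phi>_le_opnorm[of ?u i a] n False assms by (simp add: norm_scaleC H_closed norm_divide)
    then show ?thesis
      using assms False by (simp add: \<Phi>_scaleC_right norm_scaleC norm_divide field_simps)
  qed simp
qed

lemma norm_leI:
  assumes "\<And>i x. x \<in> H i \<Longrightarrow> norm x \<le> 1 \<Longrightarrow> norm (\<Phi> a i x) \<le> c"
  shows "norm a \<le> c"
  unfolding norm_eq_SUP by (intro cSUP_least opnorm_on_le) (use assms in auto)

text \<open>Identities in the algebra reduce to pointwise ones: a difference acting as zero on every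
  \<open>H i\<close> has norm 0, as the representation is isometric.\<close>

lemma \<Phi>_eqI:
  assumes "\<And>i x. x \<in> H i \<Longrightarrow> \<Phi> a i x = \<Phi> b i x"
  shows "a = b"
proof -
  have "norm (a - b) \<le> 0" by (rule norm_leI) (simp add: \<Phi>_diff assms)
  then show ?thesis by simp
qed

section \<open>Rank-one elements and minimal projections\<close>

lemma rank_one_exists:
  assumes s: "s \<in> H i"
  shows "\<exists>a. \<forall>j. \<forall>x\<in>H j. \<Phi> a j x = (if j = i then cinner x s *\<^sub>C s else 0)"
proof -
  define T where "T j = restrict (\<lambda>x. if j = i then cinner x s *\<^sub>C s else 0) (H j)" for j
  have Tj: "T j x = (if j = i then cinner x s *\<^sub>C s else 0)" if "x \<in> H j" for j x
    using that by (simp add: T_def)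
  have "T \<in> c0_sum_compact H"
    unfolding c0_sum_compact_def
  proof (safe)
    fix j
    \<comment> \<open>By Cauchy-Schwarz the unit ball is mapped to multiples of \<open>s\<close>
      with coefficients of modulus at most \<open>norm s\<close>, a compact set; coefficient 0
      covers the entries \<open>j \<noteq> i\<close>.\<close>
    let ?K = "(\<lambda>c. c *\<^sub>C s) ` cball 0 (norm s)"
    have lin: "bounded_linear (\<lambda>c. c *\<^sub>C s)"
      by (rule bounded_linear_intro[of _ "norm s"])
        (auto simp: scaleC_add_left norm_scaleC scaleR_conv_of_real
          simp flip: scaleC_of_real scaleC_scaleC)
    have "compact ?K"
      by (intro compact_continuous_image linear_continuous_on lin compact_cball)
    moreover have "T j ` (H j \<inter> cball 0 1) \<subseteq> ?K"
    proof (rule image_subsetI)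
      fix x assume x: "x \<in> H j \<inter> cball 0 1"
      have "cmod (cinner x s) \<le> 1 * norm s"
        by (rule order_trans[OF cinner_norm_le mult_right_mono]) (use x in auto)
      then show "T j x \<in> ?K"
        using x by (auto simp: Tj intro: image_eqI[of _ _ "0::complex"])
    qed
    ultimately have "compact (closure (T j ` (H j \<inter> cball 0 1)))"
      by (metis closure_minimal compact_imp_closed compact_Int_closed closed_closure inf.absorb_iff2)
    moreover have "T j \<in> H j \<rightarrow>\<^sub>E H j"
      using s by (auto simp: T_def H_closed)
    ultimately show "T j \<in> compact_operators (H j)"
      unfolding compact_operators_def
      by (auto simp: Tj H_closed cinner_add_left cinner_scaleC_left scaleC_add_left scaleC_scaleC)
  next
    fix \<epsilon> :: real assume "\<epsilon> > 0"
    have "opnorm_on (H j) (T j) < \<epsilon>" if "j \<noteq> i" for j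
    proof -
      have "opnorm_on (H j) (T j) \<le> 0"
        by (rule opnorm_on_le) (use that in \<open>simp add: Tj\<close>)
      then show ?thesis using \<open>\<epsilon> > 0\<close> by simp
    qed
    then have "{j. \<epsilon> \<le> opnorm_on (H j) (T j)} \<subseteq> {i}" by force
    then show "finite {j. \<epsilon> \<le> opnorm_on (H j) (T j)}" using finite_subset by blast
  qed
  then show ?thesis using \<Phi>_surj Tj by metis
qed

text \<open>For a unit vector \<open>s\<close> of \<open>H i\<close> this is the projection onto the
  line through \<open>s\<close>, placed in the summand \<open>i\<close>. Faithfulness of the
  representation makes the chosen element unique.\<close>

definition rank_one :: "'i \<Rightarrow> 'h \<Rightarrow> 'a" where
  "rank_one i s = (SOME a. \<forall>j. \<forall>x\<in>H j. \<Phi> a j x = (if j = i then cinner x s *\<^sub>C s else 0))"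

lemma \<Phi>_rank_one:
  "s \<in> H i \<Longrightarrow> x \<in> H j \<Longrightarrow> \<Phi> (rank_one i s) j x = (if j = i then cinner x s *\<^sub>C s else 0)"
  using someI_ex[OF rank_one_exists] unfolding rank_one_def by blast

lemma star_rank_one:
  assumes s: "s \<in> H i"
  shows "star (rank_one i s) = rank_one i s"
proof (rule \<Phi>_eqI)
  fix j x assume x: "x \<in> H j"
  \<comment> \<open>Both operators pair equally with every vector, so their difference is orthogonal
    to itself.\<close>
  let ?d = "\<Phi> (star (rank_one i s)) j x - \<Phi> (rank_one i s) j x"
  have d: "?d \<in> H j" using x by (simp add: H_closed \<Phi>_in)
  have "cinner ?d y = 0" if "y \<in> H j" for y
    using that x s cinner_commute[of y s]
    by (auto simp: cinner.diff_left \<Phi>_star \<Phi>_rank_one cinner.scaleC_right cinner_scaleC_left)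
  from this[OF d] show "\<Phi> (star (rank_one i s)) j x = \<Phi> (rank_one i s) j x"
    by (simp add: cinner_self)
qed

text \<open>For a unit vector \<open>s\<close> this is the minimality of the projection: its corner
  is one-dimensional, and the scalar is the value of the vector functional at \<open>s\<close> on
  \<open>a\<close>.\<close>

lemma rank_one_sandwich:
  assumes "s \<in> H i"
  shows "rank_one i s * a * rank_one i s = cinner (\<Phi> a i s) s *\<^sub>C rank_one i s"
proof (rule \<Phi>_eqI)
  fix j x assume x: "x \<in> H j"
  show "\<Phi> (rank_one i s * a * rank_one i s) j x = \<Phi> (cinner (\<Phi> a i s) s *\<^sub>C rank_one i s) j x"
  proof (cases "j = i")
    case True
    then have "\<Phi> (rank_one i s * a * rank_one i s) j x
      = \<Phi> (rank_one i s) i (\<Phi> a i (cinner x s *\<^sub>C s))"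
      using x assms by (simp add: \<Phi>_mult \<Phi>_in \<Phi>_rank_one H_closed(4))
    also have "\<dots> = (cinner x s * cinner (\<Phi> a i s) s) *\<^sub>C s"
      using assms by (simp only: \<Phi>_rank_one \<Phi>_in H_closed(4) if_True refl)
        (simp add: \<Phi>_scaleC_right cinner_scaleC_left)
    also have "\<dots> = \<Phi> (cinner (\<Phi> a i s) s *\<^sub>C rank_one i s) j x"
      using True x assms by (simp add: \<Phi>_scaleC \<Phi>_rank_one scaleC_scaleC mult.commute)
    finally show ?thesis .
  next
    case False
    then show ?thesis
      using x assms by (simp add: \<Phi>_mult \<Phi>_in \<Phi>_rank_one \<Phi>_scaleC)
  qed
qed

lemma rank_one_idem:
  assumes "s \<in> H i" "cinner s s = 1"
  shows "rank_one i s * rank_one i s = rank_one i s"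
  by (rule \<Phi>_eqI)
    (use assms in \<open>auto simp: \<Phi>_mult \<Phi>_in \<Phi>_rank_one H_closed cinner_scaleC_left\<close>)

lemma rank_one_nonzero:
  assumes "s \<in> H i" "cinner s s = 1"
  shows "rank_one i s \<noteq> 0"
proof
  assume "rank_one i s = 0"
  then have "s = 0" using \<Phi>_rank_one[of s i s i] assms by simp
  then show False using assms by simp
qed

text \<open>The approximated expression is \<open>(1 - u) * a * (1 - u)\<close> written without a
  unit. Only finitely many entries of \<open>a\<close> have norm at least \<open>\<epsilon>\<close>;
  in each of them compactness gives a finite rank projection that nearly fixes the image of the unit
  ball.\<close>

lemma finite_rank_projection_approx:
  assumes \<epsilon>: "\<epsilon> > 0"
  obtains I S u where "\<And>i s. i \<in> I \<Longrightarrow> s \<in> S i \<Longrightarrow> s \<in> H i \<and> cinner s s = 1"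
    "u = (\<Sum>i\<in>I. \<Sum>s\<in>S i. rank_one i s)" "norm (a - u * a - a * u + u * a * u) \<le> \<epsilon>"
proof -
  define I where "I = {i. opnorm_on (H i) (\<Phi> a i) \<ge> \<epsilon>}"
  have I: "finite I" using finite_opnorm_ge[OF \<epsilon>] by (simp add: I_def)
  have "\<exists>S. finite S \<and> S \<subseteq> H i \<and> orthonormal S \<and>
    (\<forall>x\<in>H i. norm x \<le> 1 \<longrightarrow> norm (\<Phi> a i x - fin_proj S (\<Phi> a i x)) \<le> \<epsilon>)" for i
  proof -
    let ?C = "closure (\<Phi> a i ` (H i \<inter> cball 0 1))"
    have "compact ?C" using \<Phi>_compact[of a i] unfolding compact_operators_def by blast
    \<comment> \<open>\<open>F\<close> is an \<open>\<epsilon>\<close>-net of the compact image. A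
      projection fixing \<open>F\<close> has a residual that kills the net and is contractive, hence
      is small on the whole image.\<close>
    then obtain F where F: "finite F" "F \<subseteq> ?C" "?C \<subseteq> (\<Union>x\<in>F. ball x \<epsilon>)"
      using seq_compact_imp_totally_bounded[OF compact_imp_seq_compact] \<epsilon> by metis
    have "?C \<subseteq> H i" by (rule closure_minimal) (auto simp: \<Phi>_in H_closed)
    then obtain S where S: "finite S" "S \<subseteq> H i" "orthonormal S" "\<And>x. x \<in> F \<Longrightarrow> fin_proj S x = x"
      using Gram_Schmidt[OF subspace F(1)] F(2) by (metis subset_trans)
    have "norm (\<Phi> a i x - fin_proj S (\<Phi> a i x)) \<le> \<epsilon>" if "x \<in> H i" "norm x \<le> 1" for x
    proof -
      have "\<Phi> a i x \<in> ?C" by (rule closure_subset[THEN subsetD]) (use that in auto)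
      then obtain f where f: "f \<in> F" "norm (f - \<Phi> a i x) < \<epsilon>"
        using F(3) by (auto simp: dist_norm)
      have "\<Phi> a i x - fin_proj S (\<Phi> a i x) = (\<Phi> a i x - f) - fin_proj S (\<Phi> a i x - f)"
        by (simp add: fin_proj_minus S(4)[OF f(1)])
      then have "norm (\<Phi> a i x - fin_proj S (\<Phi> a i x)) \<le> norm (\<Phi> a i x - f)"
        using fin_proj_residual_norm[OF S(1,3)] by metis
      then show ?thesis using f(2) by (simp add: norm_minus_commute)
    qed
    then show ?thesis using S by blast
  qed
  then obtain S where S: "\<And>i. finite (S i)" "\<And>i. S i \<subseteq> H i" "\<And>i. orthonormal (S i)"
    "\<And>i x. x \<in> H i \<Longrightarrow> norm x \<le> 1 \<Longrightarrow> norm (\<Phi> a i x - fin_proj (S i) (\<Phi> a i x)) \<le> \<epsilon>"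
    by metis
  define u where u: "u = (\<Sum>i\<in>I. \<Sum>s\<in>S i. rank_one i s)"
  show thesis
  proof (rule that[OF _ u])
    \<comment> \<open>In each entry \<open>u\<close> acts as a projection, which is zero outside
      \<open>I\<close>.\<close>
    have \<Phi>u: "\<Phi> u j x = (if j \<in> I then fin_proj (S j) x else 0)" if "x \<in> H j" for j x
    proof -
      have "\<Phi> u j x = (\<Sum>i\<in>I. \<Sum>s\<in>S i. if j = i then cinner x s *\<^sub>C s else 0)"
        unfolding u using that S(2) by (auto simp: \<Phi>_sum \<Phi>_rank_one subset_iff intro!: sum.cong)
      also have "\<dots> = (\<Sum>i\<in>I. if j = i then fin_proj (S i) x else 0)"
        by (intro sum.cong refl) (simp add: fin_proj_def)
      also have "\<dots> = (if j \<in> I then fin_proj (S j) x else 0)"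
        using I by simp
      finally show ?thesis .
    qed
    show "norm (a - u * a - a * u + u * a * u) \<le> \<epsilon>"
    proof (rule norm_leI)
      fix i x assume x: "x \<in> H i" "norm x \<le> 1"
      \<comment> \<open>Here \<open>y\<close> is \<open>(1 - u) x\<close>. It stays in the unit
        ball, so the bound for the residual of \<open>a\<close> applies to it directly.\<close>
      define y where "y = x - \<Phi> u i x"
      have y: "y \<in> H i" using x by (simp add: y_def H_closed \<Phi>_in)
      have "norm y \<le> norm x"
        using fin_proj_residual_norm[OF S(1,3)] x by (simp add: y_def \<Phi>u)
      with x have ny: "norm y \<le> 1" by simp
      have "\<Phi> (a - u * a - a * u + u * a * u) i x = \<Phi> a i y - \<Phi> u i (\<Phi> a i y)"
        using x by (simp add: y_def \<Phi>_diff \<Phi>_add \<Phi>_mult \<Phi>_in \<Phi>_diff_right)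
      also have "norm \<dots> \<le> \<epsilon>"
      proof (cases "i \<in> I")
        case True
        then show ?thesis using S(4)[OF y ny] y by (simp add: \<Phi>u \<Phi>_in)
      next
        case False
        then have "opnorm_on (H i) (\<Phi> a i) < \<epsilon>" by (simp add: I_def)
        then show ?thesis using False norm_\<Phi>_le_opnorm[OF y ny, of a] y by (simp add: \<Phi>u \<Phi>_in)
      qed
      finally show "norm (\<Phi> (a - u * a - a * u + u * a * u) i x) \<le> \<epsilon>" .
    qed
  qed (use S(2,3) in \<open>auto simp: orthonormal_def\<close>)
qed

end

section \<open>Hilbert modules over algebras of compact operators\<close>

lemma sum_mem_add_closed:
  assumes "0 \<in> D" "\<And>u v. u \<in> D \<Longrightarrow> v \<in> D \<Longrightarrow> u + v \<in> D" "\<And>s. s \<in> S \<Longrightarrow> g s \<in> D"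
  shows "sum g S \<in> D"
  using assms(3) by (induction S rule: infinite_finite_induct) (auto intro: assms)

context hilbert_module
begin

section \<open>Calculus of the module action and the inner product\<close>

lemma smul_zero_right [simp]: "smul a 0 = 0"
  using smul_add_right[of a 0 0] by simp

lemma smul_zero_left [simp]: "smul 0 x = 0"
  using smul_add_left[of 0 0 x] by simp

lemma smul_diff_right: "smul a (x - y) = smul a x - smul a y"
  using smul_add_right[of a "x - y" y] by simp

lemma smul_sum_left: "smul (\<Sum>s\<in>S. g s) x = (\<Sum>s\<in>S. smul (g s) x)"
  by (induction S rule: infinite_finite_induct) (auto simp: smul_add_left)

lemma ip_zero_left [simp]: "ip 0 y = 0"
  using ip_add_left[of 0 0 y] by simp

lemma ip_diff_left: "ip (x - y) z = ip x z - ip y z"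
  using ip_add_left[of "x - y" y z] by simp

lemma ip_add_right: "ip x (y + z) = ip x y + ip x z"
  using ip_star[of x "y + z"] ip_star[of x y] ip_star[of x z] by (simp add: ip_add_left star_add)

lemma ip_diff_right: "ip x (y - z) = ip x y - ip x z"
  using ip_add_right[of x "y - z" z] by simp

lemma ip_smul_right: "ip x (smul a y) = ip x y * star a"
  using ip_star[of x "smul a y"] ip_star[of x y] by (simp add: ip_smul_left star_mult)

lemma norm_sq: "(norm x)\<^sup>2 = norm (ip x x)"
  by (simp add: norm_ip)

lemma norm_smul_le: "norm (smul a x) \<le> norm a * norm x"
proof -
  have "(norm (smul a x))\<^sup>2 = norm (a * (ip x x * star a))"
    by (simp add: norm_sq ip_smul_left ip_smul_right mult.assoc)
  also have "\<dots> \<le> norm a * (norm (ip x x) * norm (star a))"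
    by (intro order_trans[OF norm_mult_ineq] mult_left_mono norm_mult_ineq) simp
  also have "\<dots> = (norm a * norm x)\<^sup>2"
    by (simp add: norm_sq[symmetric] power2_eq_square)
  finally show ?thesis by (rule power2_le_imp_le) simp
qed

lemma bounded_linear_smul: "bounded_linear (smul a)"
proof (rule bounded_linear_intro)
  show "smul a (r *\<^sub>R x) = r *\<^sub>R smul a x" for r x
    using smul_scaleC_right[of a "complex_of_real r" x] by (simp add: scaleC_of_real)
  show "norm (smul a x) \<le> norm x * norm a" for x
    using norm_smul_le[of a x] by (simp add: mult.commute)
qed (rule smul_add_right)

section \<open>Closed submodules and orthogonal complements\<close>

definition closed_submodule :: "'m set \<Rightarrow> bool" where
  "closed_submodule L \<longleftrightarrow> closed_csubspace L \<and> (\<forall>a. \<forall>x\<in>L. smul a x \<in> L)"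

definition complement :: "'m set \<Rightarrow> 'm set" where
  "complement L = {x. \<forall>z\<in>L. ip x z = 0}"

lemma complement_add: "x \<in> complement L \<Longrightarrow> y \<in> complement L \<Longrightarrow> x + y \<in> complement L"
  and complement_diff: "x \<in> complement L \<Longrightarrow> y \<in> complement L \<Longrightarrow> x - y \<in> complement L"
  and complement_scaleC: "x \<in> complement L \<Longrightarrow> c *\<^sub>C x \<in> complement L"
  and complement_smul: "x \<in> complement L \<Longrightarrow> smul a x \<in> complement L"
  by (simp_all add: complement_def ip_add_left ip_diff_left ip_scaleC_left ip_smul_left)

lemma complement_disjoint: "x \<in> L \<Longrightarrow> x \<in> complement L \<Longrightarrow> x = 0"
  by (rule ip_definite) (simp add: complement_def)

end

locale compact_type_module =
  compact_type_algebra H \<Phi> + hilbert_module smul ip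
  for H :: "'i \<Rightarrow> 'h::chilbert_space set" and \<Phi> :: "'a::cstar_algebra \<Rightarrow> 'i \<Rightarrow> 'h \<Rightarrow> 'h"
    and smul :: "'a \<Rightarrow> 'm::cbanach \<Rightarrow> 'm" and ip :: "'m \<Rightarrow> 'm \<Rightarrow> 'a"
begin

text \<open>The vector functional at \<open>\<xi>\<close> turns the module inner product into a
  scalar form. Writing \<open>ip x x\<close> as \<open>star b * b\<close> makes its diagonal the
  squared norm of \<open>\<Phi> b i \<xi>\<close>.\<close>

lemma psd_form_ip:
  assumes \<xi>: "\<xi> \<in> H i"
  shows "psd_form (\<lambda>x y. cinner (\<Phi> (ip x y) i \<xi>) \<xi>)"
proof
  fix x y z c
  show "cinner (\<Phi> (ip (x + y) z) i \<xi>) \<xi> = cinner (\<Phi> (ip x z) i \<xi>) \<xi> + cinner (\<Phi> (ip y z) i \<xi>) \<xi>"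
    using \<xi> by (simp add: ip_add_left \<Phi>_add cinner_add_left)
  show "cinner (\<Phi> (ip (c *\<^sub>C x) y) i \<xi>) \<xi> = c * cinner (\<Phi> (ip x y) i \<xi>) \<xi>"
    using \<xi> by (simp add: ip_scaleC_left \<Phi>_scaleC cinner_scaleC_left)
  have "cinner (\<Phi> (ip y x) i \<xi>) \<xi> = cinner \<xi> (\<Phi> (ip x y) i \<xi>)"
    unfolding ip_star[of y x] using \<xi> by (simp add: \<Phi>_star)
  then show "cinner (\<Phi> (ip y x) i \<xi>) \<xi> = cnj (cinner (\<Phi> (ip x y) i \<xi>) \<xi>)"
    by (simp add: cinner_commute[of "\<Phi> (ip x y) i \<xi>" \<xi>])
  obtain b where "ip x x = star b * b" using ip_nonneg unfolding cstar_nonneg_def by blast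
  then have "cinner (\<Phi> (ip x x) i \<xi>) \<xi> = cinner (\<Phi> b i \<xi>) (\<Phi> b i \<xi>)"
    using \<xi> by (simp add: \<Phi>_mult \<Phi>_star \<Phi>_in)
  then show "0 \<le> Re (cinner (\<Phi> (ip x x) i \<xi>) \<xi>)" by (simp add: cinner_self)
qed

lemma form_self_le:
  assumes \<xi>: "\<xi> \<in> H i"
  shows "Re (cinner (\<Phi> (ip x x) i \<xi>) \<xi>) \<le> (norm x * norm \<xi>)\<^sup>2"
proof -
  have "Re (cinner (\<Phi> (ip x x) i \<xi>) \<xi>) \<le> norm (\<Phi> (ip x x) i \<xi>) * norm \<xi>"
    by (rule order_trans[OF complex_Re_le_cmod cinner_norm_le])
  also have "\<dots> \<le> norm (ip x x) * norm \<xi> * norm \<xi>"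
    by (intro mult_right_mono norm_\<Phi>_le \<xi>) simp
  finally show ?thesis by (simp add: norm_sq[symmetric] power_mult_distrib power2_eq_square mult_ac)
qed

text \<open>
  The scalar Cauchy-Schwarz inequality is applied to \<open>\<langle>y,x\<rangle>\<^sup>* y\<close> and \<open>x\<close>, so that the mixed
  term becomes \<open>\<parallel>\<langle>y,x\<rangle> \<xi>\<parallel>\<^sup>2\<close>.
\<close>

lemma ip_norm_le: "norm (ip y x) \<le> norm y * norm x"
proof (rule norm_leI)
  fix i \<xi> assume \<xi>: "\<xi> \<in> H i" "norm \<xi> \<le> 1"
  interpret f: psd_form "\<lambda>x y. cinner (\<Phi> (ip x y) i \<xi>) \<xi>" by (rule psd_form_ip[OF \<xi>(1)])
  define b \<eta> where "b = ip y x" and "\<eta> = \<Phi> b i \<xi>"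
  have \<eta>: "\<eta> \<in> H i" using \<xi> by (simp add: \<eta>_def \<Phi>_in)
  have 1: "cinner (\<Phi> (ip (smul (star b) y) x) i \<xi>) \<xi> = of_real ((norm \<eta>)\<^sup>2)"
    using \<xi> by (simp add: ip_smul_left \<Phi>_mult \<Phi>_in \<Phi>_star b_def[symmetric] \<eta>_def[symmetric]
        cinner_self \<eta>)
  have 2: "cinner (\<Phi> (ip (smul (star b) y) (smul (star b) y)) i \<xi>) \<xi> = cinner (\<Phi> (ip y y) i \<eta>) \<eta>"
    using \<xi> by (simp add: ip_smul_left ip_smul_right star_star \<Phi>_mult \<Phi>_in \<Phi>_star \<eta>_def[symmetric] \<eta>)
  have "((norm \<eta>)\<^sup>2)\<^sup>2 \<le> Re (cinner (\<Phi> (ip y y) i \<eta>) \<eta>) * Re (cinner (\<Phi> (ip x x) i \<xi>) \<xi>)"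
    using f.Cauchy_Schwarz[of "smul (star b) y" x] unfolding 1 2 norm_of_real by simp
  also have "\<dots> \<le> (norm y * norm \<eta>)\<^sup>2 * (norm x * norm \<xi>)\<^sup>2"
    by (intro mult_mono form_self_le \<eta> \<xi> f.nonneg) simp
  also have "\<dots> \<le> (norm y * norm \<eta>)\<^sup>2 * (norm x * 1)\<^sup>2"
    by (intro mult_left_mono power_mono \<xi>) auto
  also have "\<dots> = (norm y * norm x * norm \<eta>)\<^sup>2" by (simp add: power_mult_distrib mult_ac)
  finally have "(norm \<eta>)\<^sup>2 \<le> norm y * norm x * norm \<eta>" by (rule power2_le_imp_le) simp
  then show "norm (\<Phi> (ip y x) i \<xi>) \<le> norm y * norm x"
    unfolding \<eta>_def b_def by (rule norm_le_by_cinner) simp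
qed

lemma tendsto_ip_left: "(f \<longlongrightarrow> x) F \<Longrightarrow> ((\<lambda>n. ip (f n) z) \<longlongrightarrow> ip x z) F"
proof -
  have "bounded_linear (\<lambda>x. ip x z)"
  proof (rule bounded_linear_intro)
    show "ip (r *\<^sub>R x) z = r *\<^sub>R ip x z" for r x
      using ip_scaleC_left[of "complex_of_real r" x z] by (simp add: scaleC_of_real)
  qed (auto simp: ip_add_left intro: ip_norm_le)
  then show "(f \<longlongrightarrow> x) F \<Longrightarrow> ((\<lambda>n. ip (f n) z) \<longlongrightarrow> ip x z) F"
    by (rule bounded_linear.tendsto)
qed

text \<open>Each of the two components \<open>w\<close> of \<open>x\<close> satisfies
  \<open>ip w w = ip x w\<close>, so Cauchy-Schwarz allows one factor \<open>norm w\<close> to be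
  cancelled.\<close>

lemma component_norm_le:
  assumes "y \<in> L" "x - y \<in> complement L"
  shows "norm y \<le> norm x" "norm (x - y) \<le> norm x"
proof -
  have xy: "ip (x - y) y = 0" using assms by (simp add: complement_def)
  then have yx: "ip y (x - y) = 0" using ip_star[of y "x - y"] by simp
  have le: "norm w \<le> norm x" if "ip w w = ip x w" for w
  proof (cases "w = 0")
    case False
    have "norm w * norm w \<le> norm x * norm w"
      using norm_sq[of w] ip_norm_le[of x w] that by (simp add: power2_eq_square)
    then show ?thesis using False by simp
  qed simp
  show "norm y \<le> norm x" by (rule le) (use xy in \<open>simp add: ip_diff_left\<close>)
  show "norm (x - y) \<le> norm x" by (rule le) (use yx in \<open>simp add: ip_diff_left\<close>)
qed

text \<open>
  For a minimal projection \<open>e\<close> the corner \<open>e A e\<close> consists of the scalar multiples of \<open>e\<close>, so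
  the part of the module fixed by \<open>e\<close> is a Hilbert space.
\<close>

lemma complement_rank_one:
  assumes L: "closed_submodule L" and s: "s \<in> H i" "cinner s s = 1"
  shows "\<exists>y\<in>L. smul (rank_one i s) x - y \<in> complement L"
proof -
  define e where "e = rank_one i s"
  define h where "h u v = cinner (\<Phi> (ip u v) i s) s" for u v
  interpret h: psd_form h unfolding h_def[abs_def] by (rule psd_form_ip[OF s(1)])
  note Ls = closed_csubspaceD[of L]
  have L': "closed_csubspace L" "\<And>a x. x \<in> L \<Longrightarrow> smul a x \<in> L"
    using L by (auto simp: closed_submodule_def)
  have e: "e * e = e" "star e = e" "e \<noteq> 0"
    unfolding e_def using s by (simp_all add: rank_one_idem star_rank_one rank_one_nonzero)
  define E where "E = {u. smul e u = u}"
  have E_diff: "u - v \<in> E" if "u \<in> E" "v \<in> E" for u v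
    using that by (simp add: E_def smul_diff_right)
  have E_add: "u + v \<in> E" if "u \<in> E" "v \<in> E" for u v
    using that by (simp add: E_def smul_add_right)
  have E_scaleC: "c *\<^sub>C u \<in> E" if "u \<in> E" for c u
    using that by (simp add: E_def smul_scaleC_right)
  have ipE: "ip u v = h u v *\<^sub>C e" if "u \<in> E" "v \<in> E" for u v
  proof -
    have "ip u v = ip (smul e u) (smul e v)" using that by (simp add: E_def)
    also have "\<dots> = e * ip u v * e" by (simp add: ip_smul_left ip_smul_right e mult.assoc)
    finally show ?thesis using rank_one_sandwich[OF s(1)] by (simp add: e_def h_def)
  qed
  have normE: "(norm u)\<^sup>2 = Re (h u u) * norm e" if "u \<in> E" for u
  proof -
    \<comment> \<open>The factor \<open>norm e\<close> is left unevaluated; its positivity is what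
      transfers minimality from the norm to \<open>h\<close>.\<close>
    have "(norm u)\<^sup>2 = cmod (h u u) * norm e" using ipE[OF that that] by (simp add: norm_sq norm_scaleC)
    also have "cmod (h u u) = Re (h u u)" using h.nonneg[of u] by (subst h.self_real) simp
    finally show ?thesis .
  qed
  define x' where "x' = smul e x"
  have x': "x' \<in> E" by (simp add: x'_def E_def smul_smul e)
  \<comment> \<open>The search is restricted to \<open>E\<close>, where the squared norm is a
    multiple of the scalar form \<open>h\<close> and so obeys the parallelogram law.\<close>
  have "\<exists>y\<in>L \<inter> E. \<forall>z\<in>L \<inter> E. norm (x' - y) \<le> norm (x' - z)"
  proof (rule nearest_point_exists)
    have "closed E"
      unfolding E_def by (intro closed_Collect_eq linear_continuous_on bounded_linear_smul continuous_on_id)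
    then show "closed (L \<inter> E)" using Ls(1)[OF L'(1)] by (rule closed_Int[rotated])
    have "0 \<in> L \<inter> E" using Ls(2)[OF L'(1)] by (simp add: E_def)
    then show "L \<inter> E \<noteq> {}" by blast
    fix u v assume uv: "u \<in> L \<inter> E" "v \<in> L \<inter> E"
    have "of_real (1/2) *\<^sub>C (u + v) \<in> L \<inter> E"
      using uv Ls(3,4)[OF L'(1)] by (auto intro!: E_scaleC E_add simp del: of_real_divide)
    then show "(1/2) *\<^sub>R (u + v) \<in> L \<inter> E" unfolding scaleC_of_real .
    have E: "x' - u \<in> E" "x' - v \<in> E" "u - v \<in> E" "(x' - u) + (x' - v) \<in> E"
      using uv x' by (auto intro: E_diff E_add)
    show "(norm ((x' - u) + (x' - v)))\<^sup>2 + (norm (u - v))\<^sup>2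
      = 2 * (norm (x' - u))\<^sup>2 + 2 * (norm (x' - v))\<^sup>2"
      unfolding normE[OF E(1)] normE[OF E(2)] normE[OF E(3)] normE[OF E(4)]
      by (simp add: h.add_left h.add_right h.diff_left h.diff_right algebra_simps)
  qed
  then obtain y where y: "y \<in> L" "y \<in> E" "\<And>z. z \<in> L \<Longrightarrow> z \<in> E \<Longrightarrow> norm (x' - y) \<le> norm (x' - z)"
    by blast
  define w where "w = x' - y"
  have w: "w \<in> E" using x' y by (simp add: w_def E_diff)
  have orth: "ip w z = 0" if z: "z \<in> L" "z \<in> E" for z
  proof -
    have "h w z = 0"
    proof (rule h.orthogonal_if_minimal)
      fix t
      have "norm w \<le> norm (x' - (y + t *\<^sub>C z))"
        unfolding w_def using y(1,2) z Ls(3,4)[OF L'(1)] by (intro y(3)) (auto intro: E_add E_scaleC)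
      then have "(norm w)\<^sup>2 \<le> (norm (w - t *\<^sub>C z))\<^sup>2" by (simp add: w_def algebra_simps)
      then have "Re (h w w) * norm e \<le> Re (h (w - t *\<^sub>C z) (w - t *\<^sub>C z)) * norm e"
        using w z by (simp add: normE E_diff E_scaleC)
      then show "Re (h w w) \<le> Re (h (w - t *\<^sub>C z) (w - t *\<^sub>C z))"
        using e(3) by simp
    qed
    then show ?thesis using ipE[OF w z(2)] by simp
  qed
  have "ip w z = 0" if z: "z \<in> L" for z
  proof (rule mult_star_eq_0)
    \<comment> \<open>Orthogonality to \<open>L \<inter> E\<close> extends to \<open>L\<close>
      through this test vector. Since \<open>w\<close> is fixed by \<open>e\<close>, its inner
      product with \<open>w\<close> is \<open>ip w z * star (ip w z)\<close>.\<close>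
    have "smul e (smul (ip w z) z) \<in> L" "smul e (smul (ip w z) z) \<in> E"
      using z L'(2) by (auto simp: E_def smul_smul e mult.assoc[symmetric])
    then have "ip w (smul e (smul (ip w z) z)) = 0" by (rule orth)
    then have "ip w z * star (ip w z) * e = 0" by (simp add: ip_smul_right e)
    moreover have "e * ip w z = ip w z" using w by (simp add: E_def ip_smul_left[symmetric])
    then have "star (ip w z) * e = star (ip w z)" using star_mult[of e "ip w z"] by (simp add: e)
    ultimately show "ip w z * star (ip w z) = 0" by (simp add: mult.assoc)
  qed
  then show ?thesis using y(1) by (auto simp: complement_def w_def x'_def e_def)
qed

theorem closed_submodule_complemented:
  assumes L: "closed_submodule L"
  shows "\<exists>y\<in>L. x - y \<in> complement L"
proof -
  \<comment> \<open>This is the sum of \<open>L\<close> and its complement. Approximants of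
    \<open>x\<close> in it are found first, and then their components are shown to converge.\<close>
  define D where "D = {x. \<exists>y\<in>L. x - y \<in> complement L}"
  have L': "closed_csubspace L" using L by (auto simp: closed_submodule_def)
  note Ls = closed_csubspaceD[OF L']
  have D_add: "u + v \<in> D" if uv: "u \<in> D" "v \<in> D" for u v
  proof -
    obtain y z where yz: "y \<in> L" "u - y \<in> complement L" "z \<in> L" "v - z \<in> complement L"
      using uv by (auto simp: D_def)
    have "(u + v) - (y + z) = (u - y) + (v - z)" by simp
    then have "(u + v) - (y + z) \<in> complement L" using complement_add[OF yz(2,4)] by metis
    then show ?thesis using Ls(3)[OF yz(1,3)] unfolding D_def by blast
  qed
  have D_zero: "0 \<in> D" unfolding D_def complement_def using Ls(2) by force
  have D_dense: "\<exists>d\<in>D. norm (x - d) \<le> \<epsilon>" if \<epsilon>: "\<epsilon> > 0" for \<epsilon>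
  proof -
    have "\<epsilon>\<^sup>2 > 0" using \<epsilon> by simp
    then obtain I S u where IS: "\<And>i s. i \<in> I \<Longrightarrow> s \<in> S i \<Longrightarrow> s \<in> H i \<and> cinner s s = 1"
      and u: "u = (\<Sum>i\<in>I. \<Sum>s\<in>S i. rank_one i s)"
      and approx: "norm (ip x x - u * ip x x - ip x x * u + u * ip x x * u) \<le> \<epsilon>\<^sup>2"
      using finite_rank_projection_approx[of "\<epsilon>\<^sup>2" "ip x x"] by blast
    have su: "star u = u"
      unfolding u star_sum using IS by (intro sum.cong refl star_rank_one) blast
    have "smul u x = (\<Sum>i\<in>I. \<Sum>s\<in>S i. smul (rank_one i s) x)" by (simp add: u smul_sum_left)
    also have "\<dots> \<in> D"
    proof (intro sum_mem_add_closed[where D = D] D_zero D_add)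
      fix i s assume "i \<in> I" "s \<in> S i"
      then show "smul (rank_one i s) x \<in> D"
        unfolding D_def using complement_rank_one[OF L, of s i x] IS by blast
    qed
    finally have "smul u x \<in> D" .
    \<comment> \<open>With \<open>u\<close> self-adjoint the expansion is exactly the approximated
      expression. The accuracy was \<open>\<epsilon>\<^sup>2\<close> because the norm of an inner
      square is a squared norm.\<close>
    moreover have "ip (x - smul u x) (x - smul u x) = ip x x - u * ip x x - ip x x * u + u * ip x x * u"
      by (simp add: ip_diff_left ip_diff_right ip_smul_left ip_smul_right su algebra_simps)
    then have "(norm (x - smul u x))\<^sup>2 \<le> \<epsilon>\<^sup>2" using approx by (simp add: norm_sq)
    then have "norm (x - smul u x) \<le> \<epsilon>" by (rule power2_le_imp_le) (use \<epsilon> in simp)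
    ultimately show ?thesis by blast
  qed
  have "\<exists>d\<in>D. norm (x - d) \<le> 1 / real (Suc n)" for n by (rule D_dense) simp
  then obtain d where d: "\<And>n. d n \<in> D" "\<And>n. norm (x - d n) \<le> 1 / real (Suc n)" by metis
  obtain y where y: "\<And>n. y n \<in> L" "\<And>n. d n - y n \<in> complement L"
    using d(1) by (simp add: D_def) metis
  have "(\<lambda>n. d n - x) \<longlonglongrightarrow> 0"
    by (rule Lim_null_comparison[OF _ LIMSEQ_inverse_real_of_nat])
      (use d(2) in \<open>auto simp: norm_minus_commute inverse_eq_divide\<close>)
  then have dx: "d \<longlonglongrightarrow> x" by (simp add: LIM_zero_iff)
  \<comment> \<open>Differences of the \<open>y n\<close> are the \<open>L\<close>-components of
    differences of the \<open>d n\<close>, so they inherit the Cauchy property.\<close>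
  have "norm (y m - y n) \<le> norm (d m - d n)" for m n
  proof (rule component_norm_le)
    show "y m - y n \<in> L" using y(1) Ls(5) by blast
    have "d m - d n - (y m - y n) = (d m - y m) - (d n - y n)" by simp
    then show "d m - d n - (y m - y n) \<in> complement L"
      using complement_diff[OF y(2)[of m] y(2)[of n]] by metis
  qed
  then have "Cauchy y"
    using LIMSEQ_imp_Cauchy[OF dx] unfolding Cauchy_iff by (meson order_le_less_trans)
  then obtain l where l: "y \<longlonglongrightarrow> l" using Cauchy_convergent convergent_def by blast
  have "l \<in> L" using closed_sequentially[OF Ls(1) y(1) l] .
  moreover have "ip (x - l) z = 0" if z: "z \<in> L" for z
  proof (rule LIMSEQ_unique)
    show "(\<lambda>n. ip (d n - y n) z) \<longlonglongrightarrow> ip (x - l) z" by (intro tendsto_ip_left tendsto_diff dx l)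
    show "(\<lambda>n. ip (d n - y n) z) \<longlonglongrightarrow> 0" using y(2) z by (simp add: complement_def)
  qed
  ultimately show ?thesis by (auto simp: complement_def)
qed

end

section \<open>Projectivity\<close>

lemma bounded_clinearD:
  assumes "bounded_clinear T"
  shows "bounded_linear T" "T (x + y) = T x + T y" "T (x - y) = T x - T y" "T 0 = 0"
    "T (c *\<^sub>C x) = c *\<^sub>C T x"
proof -
  show b: "bounded_linear T" using assms by (simp add: bounded_clinear_def)
  interpret bounded_linear T by fact
  show "T (x + y) = T x + T y" "T (x - y) = T x - T y" "T 0 = 0" by (simp_all add: add diff)
  show "T (c *\<^sub>C x) = c *\<^sub>C T x" using assms by (simp add: bounded_clinear_def)
qed

lemma bounded_clinearI:
  assumes "\<And>x y. T (x + y) = T x + T y" "\<And>c x. T (c *\<^sub>C x) = c *\<^sub>C T x"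
    "\<And>x. norm (T x) \<le> norm x * K"
  shows "bounded_clinear T"
  unfolding bounded_clinear_def
proof (intro conjI bounded_linear_intro)
  show "T (r *\<^sub>R x) = r *\<^sub>R T x" for r x
    using assms(2)[of "complex_of_real r" x] by (simp only: scaleC_of_real)
qed (use assms in auto)

text \<open>The right inverse picks the unique preimage orthogonal to the kernel. Uniqueness gives
  the algebraic properties, and the open mapping theorem gives boundedness.\<close>

lemma surjective_bimodule_map_splits:
  fixes smulN :: "'a::cstar_algebra \<Rightarrow> 'n::cbanach \<Rightarrow> 'n" and smulM :: "'a \<Rightarrow> 'm::cbanach \<Rightarrow> 'm"
    and ractN :: "'n \<Rightarrow> 'b::cstar_algebra \<Rightarrow> 'n"
  assumes cta: "compact_type_algebra H (\<Phi> :: 'a \<Rightarrow> 'i \<Rightarrow> 'h::chilbert_space \<Rightarrow> 'h)"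
    and N: "hilbert_bimodule smulN ipN ractN"
    and M: "hilbert_bimodule smulM ipM ractM"
    and T: "bimodule_map smulN ractN smulM ractM T" and surj: "surj T"
  obtains R where "bimodule_map smulM ractM smulN ractN R" "\<And>y. T (R y) = y"
proof -
  interpret compact_type_algebra H \<Phi> by (rule cta)
  interpret N: hilbert_bimodule smulN ipN ractN by (rule N)
  interpret M: hilbert_bimodule smulM ipM ractM by (rule M)
  interpret N: compact_type_module H \<Phi> smulN ipN ..
  have T': "bounded_clinear T" "\<And>a x. T (smulN a x) = smulM a (T x)"
    "\<And>x b. T (ractN x b) = ractM (T x) b"
    using T by (auto simp: bimodule_map_def)
  note Tl = bounded_clinearD[OF T'(1)]
  have ractM0: "ractM 0 b = 0" for b
    using M.ract_adjointable[of b] bounded_clinearD(4)[of "\<lambda>x. ractM x b"]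
    by (auto simp: adjointable_endos_def)
  define L where "L = {x. T x = 0}"
  have "closed L"
    unfolding L_def by (intro closed_Collect_eq linear_continuous_on Tl(1) continuous_on_const)
  then have L: "N.closed_submodule L"
    by (auto simp: N.closed_submodule_def closed_csubspace_def L_def Tl T'(2))
  let ?P = "N.complement L"
  obtain C where C: "C \<ge> 0" "\<And>y. \<exists>x. T x = y \<and> norm x \<le> C * norm y"
    using surj_bounded_linear_bounded_section[OF Tl(1) surj] by metis
  \<comment> \<open>Subtracting the kernel component of a preimage keeps its image and does not
    increase its norm, so the open mapping constant survives.\<close>
  have "\<exists>x\<in>?P. T x = y \<and> norm x \<le> C * norm y" for y
  proof -
    obtain x where x: "T x = y" "norm x \<le> C * norm y" using C(2) by blast
    obtain l where l: "l \<in> L" "x - l \<in> ?P" using N.closed_submodule_complemented[OF L] by blast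
    have "T (x - l) = y" using l(1) x by (simp add: L_def Tl(3))
    moreover have "norm (x - l) \<le> C * norm y"
      using N.component_norm_le(2)[OF l] x(2) by simp
    ultimately show ?thesis using l(2) by blast
  qed
  then obtain R where R: "\<And>y. R y \<in> ?P" "\<And>y. T (R y) = y" "\<And>y. norm (R y) \<le> C * norm y"
    by metis
  \<comment> \<open>Two preimages in the complement differ by an element of both \<open>L\<close>
    and its complement. Linearity and equivariance of \<open>R\<close> follow by exhibiting a
    suitable preimage.\<close>
  have R_eq: "R y = x" if "x \<in> ?P" "T x = y" for x y
  proof -
    have "R y - x \<in> L" "R y - x \<in> ?P"
      using that R N.complement_diff by (auto simp: L_def Tl(3))
    then show ?thesis using N.complement_disjoint by fastforce
  qed
  \<comment> \<open>The adjoint of the action of \<open>b\<close> is the action of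
    \<open>star b\<close>, which preserves the kernel because \<open>T\<close> is a bimodule map;
    hence \<open>b\<close> preserves the complement.\<close>
  have ractP: "ractN x b \<in> ?P" if "x \<in> ?P" for x b
  proof -
    have "ipN (ractN x b) z = 0" if "z \<in> L" for z
    proof -
      have "ractN z (star b) \<in> L" using that by (simp add: L_def T'(3) ractM0)
      then show ?thesis using \<open>x \<in> ?P\<close> by (simp add: N.ract_star N.complement_def)
    qed
    then show ?thesis by (simp add: N.complement_def)
  qed
  have "bimodule_map smulM ractM smulN ractN R"
    unfolding bimodule_map_def
  proof (intro conjI allI)
    show "bounded_clinear R"
    proof (rule bounded_clinearI)
      show "norm (R y) \<le> norm y * C" for y using R(3)[of y] by (simp add: mult.commute)
    qed (intro R_eq; simp add: N.complement_add N.complement_scaleC R Tl)+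
    show "R (smulM a x) = smulN a (R x)" for a x
      by (rule R_eq) (simp_all add: N.complement_smul R T'(2))
    show "R (ractM x b) = ractN (R x) b" for x b
      by (rule R_eq) (simp_all add: ractP R T'(3))
  qed
  then show thesis using that R(2) by blast
qed

lemma bimodule_map_comp:
  assumes \<phi>: "bimodule_map smulF ractF smulM ractM \<phi>" and R: "bimodule_map smulM ractM smulN ractN R"
  shows "bimodule_map smulF ractF smulN ractN (R \<circ> \<phi>)"
proof -
  have "bounded_linear (R \<circ> \<phi>)"
    unfolding o_def using \<phi> R
    by (intro bounded_linear_compose[of R \<phi>]) (auto simp: bimodule_map_def bounded_clinear_def)
  then show ?thesis using assms by (simp add: bimodule_map_def bounded_clinear_def)
qed

theorem theorem4p3:
  fixes H :: "'i \<Rightarrow> 'h::chilbert_space set"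
    and smul :: "'a::cstar_algebra \<Rightarrow> 'f::cbanach \<Rightarrow> 'f"
    and ip :: "'f \<Rightarrow> 'f \<Rightarrow> 'a"
    and ract :: "'f \<Rightarrow> 'b::cstar_algebra \<Rightarrow> 'f"
  assumes "of_type_c0_sum_compact TYPE('a) H"
    and "hilbert_bimodule smul ip ract"
  shows "projective_object TYPE('m::cbanach) TYPE('n::cbanach) smul ip ract"
proof -
  obtain \<Phi> :: "'a \<Rightarrow> 'i \<Rightarrow> 'h \<Rightarrow> 'h" where \<Phi>: "compact_type_algebra H \<Phi>"
    using assms(1) by (auto simp: of_type_c0_sum_compact_def compact_type_algebra_def)
  show ?thesis
    unfolding projective_object_def
  proof (intro conjI allI impI assms(2))
    fix smulM :: "'a \<Rightarrow> 'm \<Rightarrow> 'm" and ipM and ractM :: "'m \<Rightarrow> 'b \<Rightarrow> 'm"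
      and smulN :: "'a \<Rightarrow> 'n \<Rightarrow> 'n" and ipN and ractN :: "'n \<Rightarrow> 'b \<Rightarrow> 'n" and T \<phi>
    assume M: "hilbert_bimodule smulM ipM ractM" and N: "hilbert_bimodule smulN ipN ractN"
      and T: "bimodule_map smulN ractN smulM ractM T" "surj T"
      and \<phi>: "bimodule_map smul ract smulM ractM \<phi>"
    obtain R where R: "bimodule_map smulM ractM smulN ractN R" "\<And>y. T (R y) = y"
      using surjective_bimodule_map_splits[OF \<Phi> N M T] by blast
    have "T \<circ> (R \<circ> \<phi>) = \<phi>" by (simp add: fun_eq_iff R(2))
    then show "\<exists>\<psi>. bimodule_map smul ract smulN ractN \<psi> \<and> T \<circ> \<psi> = \<phi>"
      using bimodule_map_comp[OF \<phi> R(1)] by blast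
  qed
qed

end
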